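(* Let $n\ge 2$, let $\Omega\subset\mathbb{R}^2$ be open and simply connected, and let $A\in\mathcal{C}^1(\Omega,\mathbb{C}^{n\times n})$ have distinct singular values $\sigma_1(A(\xi))>\dots>\sigma_n(A(\xi))\ge 0$ at every $\xi\in\Omega$. Suppose that $\xi_0\in\Omega$ is a generic point of loss of rank for $A$, and that $A$ has full rank everywhere else in $\Omega$. Let $\Gamma$ be a circle centered at $\xi_0$, of radius $r>0$, entirely contained in $\Omega$, parametrized by $\gamma(t)=\xi_0+(r\cos(2\pi t),\,r\sin(2\pi t))$, $t\in[0,1]$. Let $A(\gamma(t))=U(t)\Sigma(t)V^*(t)$ be a joint-MVD of $A(\gamma(\cdot))$ over $[0,1]$, and let $\beta_j\in(-\pi,\pi]$, $j=1,\dots,n$, be defined through $$U^*(0)U(1)=V^*(0)V(1)=\operatorname{diag}(e^{i\beta_1},\dots,e^{i\beta_n}).$$ Then $$\sum_{j=1}^n\beta_j=\pi \mod 2\pi .$$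
   Context: Generic point of loss of rank: $\xi_0\in\Omega$ is a generic point of loss of rank for $A\in\mathcal{C}^1(\Omega,\mathbb{C}^{n\times n})$ if it is a regular zero of the map $F:\Omega\to\mathbb{R}^2$, $F(\xi)=(\operatorname{Re}\det A(\xi),\operatorname{Im}\det A(\xi))$, i.e. $F(\xi_0)=0$ and the derivative $DF(\xi_0)$ is invertible. Smooth SVD and joint-MVD: for $B\in\mathcal{C}^k([0,1],\mathbb{C}^{n\times n})$, $k\ge1$, with distinct nonzero singular values $\sigma_1(t)>\dots>\sigma_n(t)>0$ for all $t$, a smooth SVD is a factorization $B(t)=U(t)\Sigma(t)V^*(t)$ with $U,V$ unitary, $\Sigma=\operatorname{diag}(\sigma_1,\dots,\sigma_n)$ and all factors of class $\mathcal{C}^k$ on $[0,1]$. A joint-MVD (joint minimum variation decomposition) of $B$ is a smooth SVD whose pair $(U,V)$ minimizes $$\int_0^1\sqrt{\|\dot U(t)\|_{\mathrm F}^2+\|\dot V(t)\|_{\mathrm F}^2}\,dt$$ among all smooth SVDs of $B$; it is uniquely determined by the choice of an SVD of $B(0)$, which may be arbitrary. Here $\|\cdot\|_{\mathrm F}$ is the Frobenius norm. *)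

theory Defs
  imports "HOL-Analysis.Analysis" "HOL-Library.Real_Mod"
begin

text \<open>
  The index type \<open>'n\<close> carries a linear order, so that the singular values can be listed in
  decreasing order. The norm on \<open>complex^'n^'n\<close> is the Frobenius norm.
\<close>

type_synonym 'n cmat = "complex^'n^'n"

definition conj_transpose :: "('n::finite) cmat \<Rightarrow> 'n cmat" where
  "conj_transpose M = (\<chi> i j. cnj (M $ j $ i))"

definition unitary_matrix :: "('n::finite) cmat \<Rightarrow> bool" where
  "unitary_matrix M \<longleftrightarrow> conj_transpose M ** M = mat 1 \<and> M ** conj_transpose M = mat 1"

definition diag_matrix :: "('n::finite \<Rightarrow> complex) \<Rightarrow> 'n cmat" where
  "diag_matrix d = (\<chi> i j. if i = j then d i else 0)"

definition is_SVD ::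
  "('n::{finite,linorder}) cmat \<Rightarrow> 'n cmat \<Rightarrow> ('n \<Rightarrow> real) \<Rightarrow> 'n cmat \<Rightarrow> bool" where
  "is_SVD M U \<sigma> V \<longleftrightarrow>
     unitary_matrix U \<and> unitary_matrix V \<and> antimono \<sigma> \<and> (\<forall>j. \<sigma> j \<ge> 0) \<and>
     M = U ** diag_matrix (\<lambda>j. complex_of_real (\<sigma> j)) ** conj_transpose V"

text \<open>\<open>\<sigma>\<close> lists the singular values of \<open>M\<close> in nonincreasing order, with multiplicity.\<close>

definition has_singular_values ::
  "('n::{finite,linorder}) cmat \<Rightarrow> ('n \<Rightarrow> real) \<Rightarrow> bool" where
  "has_singular_values M \<sigma> \<longleftrightarrow> (\<exists>U V. is_SVD M U \<sigma> V)"

definition C1_on :: "'a::real_normed_vector set \<Rightarrow> ('a \<Rightarrow> 'b::real_normed_vector) \<Rightarrow> bool" where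
  "C1_on S f \<longleftrightarrow>
     (\<exists>f' :: 'a \<Rightarrow> 'a \<Rightarrow>\<^sub>L 'b.
        (\<forall>x\<in>S. (f has_derivative blinfun_apply (f' x)) (at x within S)) \<and> continuous_on S f')"

definition regular_zero ::
  "('a::real_normed_vector \<Rightarrow> 'b::real_normed_vector) \<Rightarrow> 'a \<Rightarrow> bool" where
  "regular_zero F x \<longleftrightarrow> F x = 0 \<and> (\<exists>D. (F has_derivative D) (at x) \<and> bij D)"

definition generic_loss_of_rank ::
  "(real \<times> real) set \<Rightarrow> (real \<times> real \<Rightarrow> ('n::finite) cmat) \<Rightarrow> real \<times> real \<Rightarrow> bool" where
  "generic_loss_of_rank \<Omega> A \<xi> \<longleftrightarrow>
     \<xi> \<in> \<Omega> \<and> regular_zero (\<lambda>\<zeta>. (Re (det (A \<zeta>)), Im (det (A \<zeta>)))) \<xi>"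

text \<open>Derivatives at the endpoints of \<open>[0,1]\<close> are one-sided.\<close>

definition smooth_SVD ::
  "(real \<Rightarrow> ('n::{finite,linorder}) cmat) \<Rightarrow>
   (real \<Rightarrow> 'n cmat) \<Rightarrow> (real \<Rightarrow> 'n \<Rightarrow> real) \<Rightarrow> (real \<Rightarrow> 'n cmat) \<Rightarrow> bool"
where
  "smooth_SVD B U \<sigma> V \<longleftrightarrow>
     (\<forall>t\<in>{0..1}. is_SVD (B t) (U t) (\<sigma> t) (V t) \<and> strict_antimono_on UNIV (\<sigma> t) \<and> (\<forall>j. \<sigma> t j > 0)) \<and>
     C1_on {0..1} U \<and> C1_on {0..1} V \<and>
     C1_on {0..1} (\<lambda>t. diag_matrix (\<lambda>j. complex_of_real (\<sigma> t j)))"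

definition joint_variation ::
  "(real \<Rightarrow> ('n::finite) cmat) \<Rightarrow> (real \<Rightarrow> 'n cmat) \<Rightarrow> real" where
  "joint_variation U V =
     integral {0..1} (\<lambda>t. sqrt ((norm (vector_derivative U (at t within {0..1})))\<^sup>2 +
                               (norm (vector_derivative V (at t within {0..1})))\<^sup>2))"

definition joint_MVD ::
  "(real \<Rightarrow> ('n::{finite,linorder}) cmat) \<Rightarrow>
   (real \<Rightarrow> 'n cmat) \<Rightarrow> (real \<Rightarrow> 'n \<Rightarrow> real) \<Rightarrow> (real \<Rightarrow> 'n cmat) \<Rightarrow> bool"
where
  "joint_MVD B U \<sigma> V \<longleftrightarrow>
     smooth_SVD B U \<sigma> V \<and>
     (\<forall>U' \<sigma>' V'. smooth_SVD B U' \<sigma>' V' \<longrightarrow> joint_variation U V \<le> joint_variation U' V')"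

definition circle_path :: "real \<times> real \<Rightarrow> real \<Rightarrow> real \<Rightarrow> real \<times> real" where
  "circle_path \<xi>\<^sub>0 r t = \<xi>\<^sub>0 + (r * cos (2 * pi * t), r * sin (2 * pi * t))"

end

theory Submission
  imports Defs
begin

text \<open>
  The circle surrounds a simple zero of \<open>det A\<close>, so \<open>det A\<close> winds around \<open>0\<close> an odd number of
  times (in fact \<open>\<plusminus>1\<close>) along it. In a singular value decomposition
  \<open>det (A (\<gamma> t)) = det (U t) \<cdot> \<Prod>\<^sub>j S t j \<cdot> cnj (det (V t))\<close>, so the winding is carried by the
  phases of \<open>det U\<close> and \<open>det V\<close>. Minimality of the joint variation distributes it equally:
  the phases of \<open>det U\<close> and \<open>det V\<close> move at opposite speeds, each covers half of the winding,
  and half of an odd number of turns multiplies \<open>det U\<close> by \<open>- 1\<close>. Since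
  \<open>det (U 1) / det (U 0) = cis (\<Sum>\<^sub>j \<beta> j)\<close>, this is the claim.

  The equal distribution is a first-order optimality condition. Multiplying \<open>U\<close> and \<open>V\<close> by the
  same scalar phase \<open>cis (\<phi> t)\<close> yields another smooth decomposition, and the choice of \<open>\<phi>\<close>
  in \<open>joint_MVD_trace\<close> lowers the integrand wherever the traces of \<open>U\<^sup>* U'\<close> and \<open>V\<^sup>* V'\<close>
  do not cancel. By Jacobi's formula their sum is the logarithmic derivative of \<open>det U \<cdot> det V\<close>,
  which is therefore a constant \<open>c\<close> (\<open>joint_MVD_det_mult_constant\<close>). Consequently
  \<open>det U \<cdot> sqrt \<bar>det A\<bar> / sqrt c\<close> is a continuous square root of \<open>det A\<close> along the circle
  (\<open>joint_MVD_det_squared\<close>).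

  Winding numbers are replaced by the behaviour of continuous square roots: a continuous square
  root of a loop changes sign after one turn exactly if the winding number is odd. A loop that is
  deformed, away from \<open>0\<close>, into one with \<open>q (t + 1/2) = - q t\<close> has this property
  (\<open>sqrt_along_odd_loop\<close>). Rescaling circles down to a regular zero deforms the loop into the
  image of the unit circle under the derivative, which is odd because the derivative is linear
  (\<open>sqrt_around_regular_zero\<close>). The same criterion shows that the disc bounded by the
  circle lies in \<open>\<Omega>\<close> (\<open>disc_subset_of_simply_connected\<close>), so that no further zeros are enclosed.
\<close>

section \<open>Continuous square roots along loops\<close>

text \<open>The quotient \<open>f / g\<close> is continuous with values in \<open>{1, -1}\<close>.\<close>

lemma square_eq_imp_ratio_constant:
  fixes f g :: "'a::topological_space \<Rightarrow> complex"
  assumes S: "connected S" and f: "continuous_on S f" and g: "continuous_on S g"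
    and sq: "\<And>x. x \<in> S \<Longrightarrow> (f x)\<^sup>2 = (g x)\<^sup>2" and nz: "\<And>x. x \<in> S \<Longrightarrow> g x \<noteq> 0"
    and xy: "x \<in> S" "y \<in> S"
  shows "f x * g y = f y * g x"
proof -
  let ?h = "\<lambda>x. f x / g x"
  have cont: "continuous_on S ?h"
    using f g nz by (intro continuous_intros) auto
  have val: "?h z \<in> {1, -1}" if "z \<in> S" for z
    using sq[OF that] nz[OF that] by (auto simp: power2_eq_iff)
  have "finite (?h ` S)"
    using val finite_subset[of "?h ` S" "{1,-1}"] by blast
  then have "?h constant_on S"
    using continuous_finite_range_constant[OF S cont] by blast
  then have "?h x = ?h y"
    using xy by (auto simp: constant_on_def)
  then show ?thesis
    using nz xy by (simp add: field_simps)
qed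

text \<open>
  The map \<open>Q\<close> is a homotopy of loops from \<open>t \<mapsto> Q (0, t)\<close> to \<open>t \<mapsto> Q (r, t)\<close>. A square root \<open>H\<close> of
  \<open>Q\<close> exists on the contractible rectangle. By oddness, \<open>H (0, t + 1/2) / H (0, t)\<close> is a
  square root of \<open>- 1\<close> and hence constant in \<open>t\<close>; applying it twice gives the sign \<open>- 1\<close> over a full
  turn. The sign \<open>H (s, 1) / H (s, 0)\<close> cannot change with \<open>s\<close>, and \<open>k\<close> agrees with \<open>H (r, \<cdot>)\<close>
  up to a constant sign.
\<close>

lemma sqrt_along_odd_loop:
  fixes Q :: "real \<times> real \<Rightarrow> complex" and k :: "real \<Rightarrow> complex"
  assumes r: "0 \<le> r"
    and Q: "continuous_on ({0..r} \<times> {0..1}) Q"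
    and nz: "\<And>s t. s \<in> {0..r} \<Longrightarrow> t \<in> {0..1} \<Longrightarrow> Q (s, t) \<noteq> 0"
    and loop: "\<And>s. s \<in> {0..r} \<Longrightarrow> Q (s, 1) = Q (s, 0)"
    and odd: "\<And>t. t \<in> {0..1/2} \<Longrightarrow> Q (0, t + 1/2) = - Q (0, t)"
    and k: "continuous_on {0..1} k" "\<And>t. t \<in> {0..1} \<Longrightarrow> (k t)\<^sup>2 = Q (r, t)"
  shows "k 1 = - k 0"
proof -
  have "convex ({0..r} \<times> {0..1::real})"
    by (intro convex_Times convex_real_interval)
  then have "contractible ({0..r} \<times> {0..1::real})"
    by (rule convex_imp_contractible)
  with Q obtain H where H: "continuous_on ({0..r} \<times> {0..1}) H"
    and HQ: "\<And>x. x \<in> {0..r} \<times> {0..1} \<Longrightarrow> Q x = (H x)\<^sup>2"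
    using continuous_sqrt_on_contractible[of "{0..r} \<times> {0..1}" Q] nz by blast
  have HQ': "(H (s, t))\<^sup>2 = Q (s, t)" if "s \<in> {0..r}" "t \<in> {0..1}" for s t
    using HQ[of "(s, t)"] that by simp
  have Hnz: "H (s, t) \<noteq> 0" if "s \<in> {0..r}" "t \<in> {0..1}" for s t
    using HQ'[OF that] nz[OF that] by auto
  have Hcomp: "continuous_on T (\<lambda>x. H (p x))"
    if "continuous_on T p" "p ` T \<subseteq> {0..r} \<times> {0..1}" for T :: "real set" and p
    using continuous_on_compose2[OF H] that by blast
  have "H (0, 0 + 1/2) * (\<i> * H (0, 1/2)) = H (0, 1/2 + 1/2) * (\<i> * H (0, 0))"
    by (rule square_eq_imp_ratio_constant[where S = "{0..1/2}" and f = "\<lambda>t. H (0, t + 1/2)"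
          and g = "\<lambda>t. \<i> * H (0, t)"])
      (use r in \<open>auto simp: power_mult_distrib HQ' Hnz odd intro!: continuous_intros Hcomp\<close>)
  then have "H (0, 1) * H (0, 0) = (H (0, 1/2))\<^sup>2"
    by (simp add: power2_eq_square)
  also have "\<dots> = - (H (0, 0))\<^sup>2"
    using r odd[of 0] by (simp add: HQ')
  finally have H0: "H (0, 1) = - H (0, 0)"
    using Hnz[of 0 0] r by (simp add: power2_eq_square eq_neg_iff_add_eq_0 flip: distrib_right)
  have "H (0, 1) * H (r, 0) = H (r, 1) * H (0, 0)"
    by (rule square_eq_imp_ratio_constant[where S = "{0..r}" and f = "\<lambda>s. H (s, 1)"
          and g = "\<lambda>s. H (s, 0)"])
      (use r in \<open>auto simp: HQ' Hnz loop intro!: continuous_intros Hcomp\<close>)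
  then have "H (0, 0) * H (r, 1) = H (0, 0) * - H (r, 0)"
    by (simp add: H0 mult.commute)
  then have Hr: "H (r, 1) = - H (r, 0)"
    using Hnz[of 0 0] r by (simp only: mult_cancel_left) auto
  have "k 0 * H (r, 1) = k 1 * H (r, 0)"
    by (rule square_eq_imp_ratio_constant[where S = "{0..1}" and f = k and g = "\<lambda>t. H (r, t)"])
      (use r k in \<open>auto simp: HQ' Hnz intro!: continuous_intros Hcomp\<close>)
  then have "H (r, 0) * k 1 = H (r, 0) * - k 0"
    by (simp add: Hr mult.commute)
  then show ?thesis
    using Hnz[of r 0] r by (simp only: mult_cancel_left) auto
qed

text \<open>
  The angle is measured in full turns, so that the parameter interval \<open>[0, 1]\<close> is one turn and
  the antipodal map is the shift by \<open>1/2\<close>.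
\<close>

definition unit_vector :: "real \<Rightarrow> real \<times> real" where
  "unit_vector t = (cos (2 * pi * t), sin (2 * pi * t))"

lemma circle_path_eq: "circle_path x r t = x + r *\<^sub>R unit_vector t"
  by (simp add: circle_path_def unit_vector_def)

lemma norm_unit_vector [simp]: "norm (unit_vector t) = 1"
  by (simp add: unit_vector_def norm_prod_def)

lemma unit_vector_nonzero: "unit_vector t \<noteq> 0"
  by (metis norm_unit_vector norm_zero zero_neq_one)

lemma unit_vector_antipodal: "unit_vector (t + 1/2) = - unit_vector t"
  by (simp add: unit_vector_def distrib_left cos_add sin_add)

lemma unit_vector_one: "unit_vector 1 = unit_vector 0"
  by (simp add: unit_vector_def)

lemma continuous_on_unit_vector [continuous_intros]:
  "continuous_on S f \<Longrightarrow> continuous_on S (\<lambda>x. unit_vector (f x))"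
  for f :: "'a::t2_space \<Rightarrow> real"
  unfolding unit_vector_def by (intro continuous_intros)

text \<open>
  If \<open>\<Omega>\<close> missed a point \<open>p\<close> of the disc, then \<open>y - p\<close>, read as a complex number, would have a
  continuous square root on the simply connected set \<open>\<Omega>\<close>, hence one along the circle that returns to
  its initial value. But moving \<open>p\<close> to the centre deforms the loop \<open>y - p\<close> into an odd one.
\<close>

lemma disc_subset_of_simply_connected:
  fixes \<Omega> :: "(real \<times> real) set"
  assumes "open \<Omega>" "simply_connected \<Omega>" "0 < r" "sphere x r \<subseteq> \<Omega>"
  shows "cball x r \<subseteq> \<Omega>"
proof (rule ccontr)
  assume "\<not> cball x r \<subseteq> \<Omega>"
  then obtain p where p: "dist x p \<le> r" "p \<notin> \<Omega>"
    by (meson mem_cball subsetI)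
  then have pr: "dist x p < r"
    using assms(4) by force
  \<comment> \<open>the identification of the plane with the complex numbers\<close>
  define z :: "real \<times> real \<Rightarrow> complex" where "z y = Complex (fst y) (snd y)" for y
  have z_norm: "norm (z y) = norm y" for y
    by (simp add: z_def complex_norm norm_prod_def)
  have z_cont: "continuous_on S (\<lambda>x. z (f x))" if "continuous_on S f"
    for S :: "'b::topological_space set" and f
    unfolding z_def using that by (auto simp: Complex_eq intro!: continuous_intros)
  have cont: "continuous_on \<Omega> (\<lambda>y. z (y - p))"
    by (intro z_cont continuous_intros)
  have nz: "z (y - p) \<noteq> 0" if "y \<in> \<Omega>" for y
    using p(2) that z_norm[of "y - p"] by auto
  obtain h where h: "continuous_on \<Omega> h" "\<And>y. y \<in> \<Omega> \<Longrightarrow> z (y - p) = (h y)\<^sup>2"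
    using continuous_sqrt_on_simply_connected
      [OF cont assms(2) open_imp_locally_path_connected[OF assms(1)] nz] by blast
  have mem: "circle_path x r t \<in> \<Omega>" for t
    using assms(3,4) by (auto simp: circle_path_eq dist_norm)
  let ?k = "\<lambda>t. h (circle_path x r t)"
  let ?Q = "\<lambda>a. z (r *\<^sub>R unit_vector (snd a) - fst a *\<^sub>R (p - x))"
  have "?k 1 = - ?k 0"
  proof (rule sqrt_along_odd_loop[where Q = ?Q and r = 1])
    show "continuous_on ({0..1} \<times> {0..1}) ?Q"
      by (intro z_cont continuous_intros)
    show "continuous_on {0..1} ?k"
      by (rule continuous_on_compose2[OF h(1)])
        (auto simp: circle_path_eq assms(3) mem[unfolded circle_path_eq] intro!: continuous_intros)
    fix s t :: real
    assume s: "s \<in> {0..1}"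
    show "?Q (s, t) \<noteq> 0"
    proof
      assume "?Q (s, t) = 0"
      then have "r *\<^sub>R unit_vector t - s *\<^sub>R (p - x) = 0"
        using z_norm[of "r *\<^sub>R unit_vector t - s *\<^sub>R (p - x)"] by simp
      then have "norm (r *\<^sub>R unit_vector t) = norm (s *\<^sub>R (p - x))"
        by simp
      then have "r = s * dist x p"
        using assms(3) s by (simp add: dist_norm norm_minus_commute)
      also have "\<dots> \<le> dist x p"
        using s by (simp add: mult_left_le_one_le)
      finally show False using pr by simp
    qed
  next
    fix t :: real assume "t \<in> {0..1/2}"
    show "?Q (0, t + 1/2) = - ?Q (0, t)"
      by (simp add: unit_vector_antipodal z_def complex_eq_iff)
  qed (auto simp: unit_vector_one circle_path_eq algebra_simps
         h(2)[symmetric] mem[unfolded circle_path_eq])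
  moreover have "?k 1 = ?k 0"
    by (simp add: circle_path_eq unit_vector_one)
  moreover have "?k 0 \<noteq> 0"
  proof
    assume "?k 0 = 0"
    then have "z (circle_path x r 0 - p) = 0"
      using h(2)[OF mem[of 0]] by simp
    then have "circle_path x r 0 = p"
      using z_norm[of "circle_path x r 0 - p"] by simp
    with mem[of 0] p(2) show False by simp
  qed
  ultimately show False by simp
qed

text \<open>
  The rescaled loops \<open>t \<mapsto> f (x + s u(t)) / s\<close>, with \<open>u(t)\<close> on the unit circle, extend continuously
  to \<open>s = 0\<close> by the odd loop \<open>t \<mapsto> L u(t)\<close>.
\<close>

lemma sqrt_around_regular_zero:
  fixes f :: "real \<times> real \<Rightarrow> complex" and k :: "real \<Rightarrow> complex"
  assumes r: "0 < r" and cont: "continuous_on (cball x r) f"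
    and nz: "\<And>y. y \<in> cball x r - {x} \<Longrightarrow> f y \<noteq> 0" and zero: "f x = 0"
    and der: "(f has_derivative L) (at x)" and L: "\<And>h. h \<noteq> 0 \<Longrightarrow> L h \<noteq> 0"
    and k: "continuous_on {0..1} k" "\<And>t. t \<in> {0..1} \<Longrightarrow> (k t)\<^sup>2 = f (circle_path x r t)"
  shows "k 1 = - k 0"
proof -
  interpret L: bounded_linear L
    using der by (rule has_derivative_bounded_linear)
  \<comment> \<open>The relative error of the linearisation; division by zero makes it vanish at \<open>0\<close>, which is
    its limit there by differentiability.\<close>
  define \<kappa> where "\<kappa> h = (f (x + h) - L h) /\<^sub>R norm h" for h
  have \<kappa>: "continuous_on (cball 0 r) \<kappa>"
    unfolding continuous_on_eq_continuous_within
  proof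
    fix h :: "real \<times> real" assume h: "h \<in> cball 0 r"
    show "continuous (at h within cball 0 r) \<kappa>"
    proof (cases "h = 0")
      case True
      have "((\<lambda>h. norm (f (x + h) - f x - L h) / norm h) \<longlongrightarrow> 0) (at 0)"
        using der by (simp add: has_derivative_at)
      then have "((\<lambda>h. norm (\<kappa> h)) \<longlongrightarrow> 0) (at 0)"
        by (simp add: zero \<kappa>_def divide_inverse mult.commute)
      then have "(\<kappa> \<longlongrightarrow> 0) (at 0)"
        by (rule tendsto_norm_zero_cancel)
      then show ?thesis
        unfolding True continuous_within
        by (auto simp: \<kappa>_def intro: tendsto_within_subset)
    next
      case False
      have "continuous_on (cball 0 r) (\<lambda>h. f (x + h))"
        by (rule continuous_on_compose2[OF cont]) (auto intro!: continuous_intros simp: dist_norm)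
      with False h show ?thesis
        unfolding \<kappa>_def continuous_on_eq_continuous_within
        by (intro continuous_intros L.continuous) auto
    qed
  qed
  let ?Q = "\<lambda>a. L (unit_vector (snd a)) + \<kappa> (fst a *\<^sub>R unit_vector (snd a))"
  have Q: "?Q (s, t) = f (x + s *\<^sub>R unit_vector t) /\<^sub>R s" if "0 < s" for s t
    using that by (simp add: \<kappa>_def L.scaleR divide_simps scaleR_diff_right)
  have Q0: "?Q (0, t) = L (unit_vector t)" for t
    by (simp add: \<kappa>_def)
  let ?k = "\<lambda>t. k t /\<^sub>R sqrt r"
  have "?k 1 = - ?k 0"
  proof (rule sqrt_along_odd_loop[where Q = ?Q and r = r])
    have "continuous_on ({0..r} \<times> {0..1}) (\<lambda>a. \<kappa> (fst a *\<^sub>R unit_vector (snd a)))"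
      by (rule continuous_on_compose2[OF \<kappa>]) (auto intro!: continuous_intros)
    then show "continuous_on ({0..r} \<times> {0..1}) ?Q"
      by (intro continuous_intros L.continuous_on)
    show "continuous_on {0..1} ?k"
      by (intro continuous_intros k)
    show "?Q (s, 1) = ?Q (s, 0)" for s
      by (simp add: unit_vector_one)
    show "?Q (0, t + 1/2) = - ?Q (0, t)" for t
      unfolding Q0 by (simp add: unit_vector_antipodal linear_neg[OF L.linear])
    show "(?k t)\<^sup>2 = ?Q (r, t)" if "t \<in> {0..1}" for t
      unfolding Q[OF r] using k(2)[OF that] r
      by (simp add: circle_path_eq scaleR_conv_of_real power_mult_distrib power_inverse
          flip: of_real_power)
    show "?Q (s, t) \<noteq> 0" if "s \<in> {0..r}" for s t
    proof (cases "s = 0")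
      case True
      then show ?thesis using L[OF unit_vector_nonzero] Q0 by simp
    next
      case False
      with that have "x + s *\<^sub>R unit_vector t \<in> cball x r - {x}"
        using unit_vector_nonzero by (auto simp: dist_norm)
      from nz[OF this] show ?thesis
        using False that Q[of s t] by simp
    qed
  qed (use r in auto)
  then show ?thesis using r by (simp flip: scaleR_minus_right)
qed



section \<open>Unitary matrices, phases and determinants\<close>

text \<open>
  The vector space \<open>complex^'n^'n\<close> is a real one, so that multiplication by a complex scalar is a
  separate operation.
\<close>

definition cscale :: "complex \<Rightarrow> 'n::finite cmat \<Rightarrow> 'n cmat" where
  "cscale c M = (\<chi> i j. c * M $ i $ j)"

lemma norm_cscale: "norm (cscale c M) = norm c * norm M"
  by (simp add: cscale_def norm_vec_def norm_mult L2_set_right_distrib)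

lemma bounded_bilinear_cscale: "bounded_bilinear cscale"
proof
  show "\<exists>K. \<forall>a b. norm (cscale a b) \<le> norm a * norm b * K"
    by (rule exI[of _ 1]) (simp add: norm_cscale)
qed (simp_all add: cscale_def vec_eq_iff algebra_simps)

interpretation cscale: bounded_bilinear cscale
  by (rule bounded_bilinear_cscale)

lemma cscale_cscale: "cscale a (cscale b M) = cscale (a * b) M"
  by (simp add: cscale_def vec_eq_iff mult.assoc)

lemma cscale_1: "cscale 1 M = M"
  by (simp add: cscale_def vec_eq_iff)

lemma cscale_mult: "cscale a M ** N = cscale a (M ** N)" "M ** cscale a N = cscale a (M ** N)"
  by (simp_all add: cscale_def vec_eq_iff matrix_matrix_mult_def sum_distrib_left ac_simps)

lemma conj_transpose_cscale: "conj_transpose (cscale a M) = cscale (cnj a) (conj_transpose M)"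
  by (simp add: cscale_def vec_eq_iff conj_transpose_def)

lemma cis_cnj_cancel: "cis \<phi> * cnj (cis \<phi>) = 1" "cnj (cis \<phi>) * cis \<phi> = 1"
  by (simp_all add: cis_cnj cis_mult)

lemma is_SVD_phase:
  assumes "is_SVD M U \<sigma> V"
  shows "is_SVD M (cscale (cis \<phi>) U) \<sigma> (cscale (cis \<phi>) V)"
  using assms
  by (simp add: is_SVD_def unitary_matrix_def conj_transpose_cscale cscale_mult cscale_cscale
      cscale_1 cis_cnj_cancel)

lemma trace_conj_transpose_mult:
  "trace (conj_transpose M ** N) = (\<Sum>i\<in>UNIV. \<Sum>j\<in>UNIV. cnj (M $ i $ j) * N $ i $ j)"
  unfolding trace_def conj_transpose_def matrix_matrix_mult_def
  by (simp, rule sum.swap)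

lemma inner_eq_Re_trace: "inner M N = Re (trace (conj_transpose M ** N))"
  by (simp add: trace_conj_transpose_mult inner_vec_def inner_complex_def)

lemma inner_i_eq_Im_trace: "inner (cscale \<i> M) N = Im (trace (conj_transpose M ** N))"
  by (simp add: trace_conj_transpose_mult inner_vec_def inner_complex_def cscale_def algebra_simps)

lemma norm_unitary:
  assumes "unitary_matrix (M :: 'n::finite cmat)"
  shows "(norm M)\<^sup>2 = CARD('n)"
  using assms
  by (simp add: power2_norm_eq_inner inner_eq_Re_trace unitary_matrix_def trace_def mat_def)

text \<open>
  A linear map on the reals is determined by its value at \<open>1\<close>, so continuity of the derivative
  as an operator amounts to continuity of the velocity.
\<close>

lemma C1_on_iff_vector_derivative:
  fixes f :: "real \<Rightarrow> 'b::real_normed_vector"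
  shows "C1_on S f \<longleftrightarrow>
    (\<exists>f'. (\<forall>t\<in>S. (f has_vector_derivative f' t) (at t within S)) \<and> continuous_on S f')"
proof
  assume "C1_on S f"
  then obtain f' where f': "\<And>t. t \<in> S \<Longrightarrow> (f has_derivative blinfun_apply (f' t)) (at t within S)"
    "continuous_on S f'"
    unfolding C1_on_def by blast
  have "blinfun_apply (f' t) = (\<lambda>x. x *\<^sub>R blinfun_apply (f' t) 1)" for t
    by (rule ext) (metis blinfun.scaleR_right real_scaleR_def mult.right_neutral)
  then show "\<exists>f'. (\<forall>t\<in>S. (f has_vector_derivative f' t) (at t within S)) \<and> continuous_on S f'"
    using f' unfolding has_vector_derivative_def
    by (intro exI[of _ "\<lambda>t. blinfun_apply (f' t) 1"]) (auto intro!: continuous_intros)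
next
  assume "\<exists>f'. (\<forall>t\<in>S. (f has_vector_derivative f' t) (at t within S)) \<and> continuous_on S f'"
  then obtain f' where f': "\<forall>t\<in>S. (f has_vector_derivative f' t) (at t within S)"
    "continuous_on S f'"
    by blast
  then show "C1_on S f"
    unfolding C1_on_def has_vector_derivative_eq_has_derivative_blinfun
    by (intro exI[of _ "\<lambda>t. blinfun_scaleR_left (f' t)"] conjI continuous_intros) auto
qed

text \<open>
  The left-hand side is the squared speed of \<open>cis (\<phi> t) M(t)\<close>, where \<open>N\<close> is the velocity of \<open>M\<close>
  and \<open>a\<close> that of \<open>\<phi>\<close>. The common factor \<open>cis \<phi>\<close> does not affect the norm, so the speed is
  quadratic in \<open>a\<close>.
\<close>

lemma norm_rotating_frame:
  fixes a :: real
  assumes "(norm M)\<^sup>2 = n"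
  shows "(norm (cscale (cis \<phi>) N + cscale (\<i> * complex_of_real a * cis \<phi>) M))\<^sup>2 =
    (norm N)\<^sup>2 + 2 * a * inner (cscale \<i> M) N + a\<^sup>2 * n"
proof -
  have "cscale (cis \<phi>) N + cscale (\<i> * complex_of_real a * cis \<phi>) M =
    cscale (cis \<phi>) (N + a *\<^sub>R cscale \<i> M)"
    by (simp add: vec_eq_iff cscale_def algebra_simps scaleR_conv_of_real[where 'a = complex])
  then have "(norm (cscale (cis \<phi>) N + cscale (\<i> * complex_of_real a * cis \<phi>) M))\<^sup>2 =
    (norm (N + a *\<^sub>R cscale \<i> M))\<^sup>2"
    by (simp add: norm_cscale)
  also have "\<dots> = (norm N)\<^sup>2 + 2 * a * inner (cscale \<i> M) N + a\<^sup>2 * (norm (cscale \<i> M))\<^sup>2"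
    unfolding power2_norm_eq_inner by (simp add: algebra_simps power2_eq_square inner_commute)
  finally show ?thesis by (simp add: norm_cscale assms)
qed

lemma cis_has_vector_derivative:
  assumes "(\<phi> has_vector_derivative a) (at t within S)"
  shows "((\<lambda>t. cis (\<phi> t)) has_vector_derivative \<i> * complex_of_real a * cis (\<phi> t)) (at t within S)"
proof -
  have "(cis has_derivative (\<lambda>x. x *\<^sub>R (\<i> * cis (\<phi> t)))) (at (\<phi> t))"
    by (auto intro!: derivative_eq_intros simp: scaleR_conv_of_real)
  from has_derivative_compose[OF assms[unfolded has_vector_derivative_def] this]
  show ?thesis
    by (simp add: has_vector_derivative_def scaleR_conv_of_real ac_simps)
qed

lemma det_conj_transpose: "det (conj_transpose M) = cnj (det M)"
proof -
  have "det (conj_transpose M) = det (transpose (conj_transpose M))"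
    by (simp add: det_transpose)
  also have "\<dots> = cnj (det M)"
    by (simp add: det_def transpose_def conj_transpose_def)
  finally show ?thesis .
qed

lemma det_unitary: "unitary_matrix U \<Longrightarrow> cnj (det U) * det U = 1"
  unfolding unitary_matrix_def by (metis det_I det_conj_transpose det_mul)

lemma cis_prod: "(\<Prod>i\<in>I. cis (f i)) = cis (\<Sum>i\<in>I. f i)"
  by (induction I rule: infinite_finite_induct) (simp_all add: cis_mult)

lemma det_diag_matrix: "det (diag_matrix d) = (\<Prod>i\<in>UNIV. d i)"
  by (simp add: det_diagonal diag_matrix_def)

lemma det_nonzero_of_full_rank:
  fixes M :: "'a::field^'n^'n"
  assumes "rank M = CARD('n)"
  shows "det M \<noteq> 0"
proof -
  have "vec.span (rows M) = UNIV"
    using assms vec.dim_eq_full[of "rows M"]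
    by (simp add: row_rank_def_gen vec_dim_card vec.dimension_def card_cart_basis)
  then show ?thesis
    by (metis invertible_det_nz invertible_left_inverse matrix_left_invertible_span_rows_gen)
qed

lemma continuous_on_det:
  fixes M :: "'a::topological_space \<Rightarrow> 'n::finite cmat"
  assumes "continuous_on T M"
  shows "continuous_on T (\<lambda>x. det (M x))"
  unfolding det_def by (intro continuous_intros assms)

text \<open>
  In the Leibniz expansion, the term of a permutation \<open>p\<close> is a product of entries of the identity
  matrix with one factor replaced. A permutation other than the identity moves at least two
  indices, so at least one off-diagonal factor \<open>0\<close> remains.
\<close>

lemma det_has_derivative_mat_1:
  "((det :: 'n::finite cmat \<Rightarrow> complex) has_derivative trace) (at (mat 1))"
proof -
  have "((det :: 'n cmat \<Rightarrow> complex) has_derivative (\<lambda>H. \<Sum>p | p permutes UNIV. of_int (sign p) *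
      (\<Sum>i\<in>UNIV. H $ i $ p i * (\<Prod>j\<in>UNIV - {i}. mat 1 $ j $ p j)))) (at (mat 1))"
    unfolding det_def[abs_def]
    by (intro has_derivative_sum has_derivative_mult_right has_derivative_prod
        bounded_linear_imp_has_derivative
        bounded_linear_compose[OF bounded_linear_vec_nth bounded_linear_vec_nth])
  moreover have "(\<Sum>p | p permutes UNIV. of_int (sign p) *
      (\<Sum>i\<in>UNIV. H $ i $ p i * (\<Prod>j\<in>UNIV - {i}. mat 1 $ j $ p j))) = trace H" for H :: "'n cmat"
  proof -
    have "(\<Prod>j\<in>UNIV - {i}. (mat 1 :: 'n cmat) $ j $ p j) = 0"
      if p: "p permutes UNIV" "p \<noteq> id" for p i
    proof -
      have "\<exists>j. j \<noteq> i \<and> p j \<noteq> j"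
      proof (rule ccontr)
        assume "\<nexists>j. j \<noteq> i \<and> p j \<noteq> j"
        then have fix_off: "p j = j" if "j \<noteq> i" for j
          using that by blast
        then have "p i = i"
          using permutes_inj[OF p(1)] by (metis injD)
        with fix_off p(2) show False
          by (metis eq_id_iff)
      qed
      then obtain j where "j \<in> UNIV - {i}" "(mat 1 :: 'n cmat) $ j $ p j = 0"
        by (auto simp: mat_def)
      then show ?thesis
        by (intro prod_zero) auto
    qed
    then have "(\<Sum>p | p permutes UNIV. of_int (sign p) *
      (\<Sum>i\<in>UNIV. H $ i $ p i * (\<Prod>j\<in>UNIV - {i}. mat 1 $ j $ p j))) =
      (\<Sum>p\<in>{id}. of_int (sign p) *
      (\<Sum>i\<in>UNIV. H $ i $ p i * (\<Prod>j\<in>UNIV - {i}. mat 1 $ j $ p j)))"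
      by (intro sum.mono_neutral_right) (simp_all add: permutes_id del: prod_zero_iff)
    then show ?thesis
      by (simp add: trace_def mat_def)
  qed
  ultimately show ?thesis
    by (rule has_derivative_eq_rhs[OF _ ext])
qed

text \<open>
  Left translation by \<open>(U t)\<^sup>*\<close> moves the base point to the identity matrix.
\<close>

lemma det_unitary_has_vector_derivative:
  assumes "(U has_vector_derivative u) (at t within S)" and "unitary_matrix (U t)"
  shows "((\<lambda>t. det (U t)) has_vector_derivative det (U t) * trace (conj_transpose (U t) ** u))
    (at t within S)"
proof -
  have inv: "conj_transpose (U t) ** U t = mat 1" "U t ** conj_transpose (U t) = mat 1"
    using assms(2) by (auto simp: unitary_matrix_def)
  have lin: "bounded_linear (\<lambda>X. conj_transpose (U t) ** X)"
    unfolding linear_conv_bounded_linear[symmetric]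
    by (intro linearI) (simp_all add: matrix_matrix_mult_def vec_eq_iff distrib_left sum.distrib
        scaleR_sum_right)
  have "((\<lambda>s. conj_transpose (U t) ** U s) has_vector_derivative conj_transpose (U t) ** u)
    (at t within S)"
    using bounded_linear.has_vector_derivative[OF lin assms(1)] .
  then have "((\<lambda>s. det (conj_transpose (U t) ** U s)) has_vector_derivative
      trace (conj_transpose (U t) ** u)) (at t within S)"
    unfolding has_vector_derivative_def
    using has_derivative_compose[where g = det and g' = trace] det_has_derivative_mat_1
    by (fastforce simp: inv(1) trace_def scaleR_sum_right)
  then have "((\<lambda>s. det (U t) * det (conj_transpose (U t) ** U s)) has_vector_derivative
      det (U t) * trace (conj_transpose (U t) ** u)) (at t within S)"
    by (rule has_vector_derivative_mult_right)
  then show ?thesis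
    by (simp add: matrix_mul_assoc inv flip: det_mul)
qed


text \<open>
  The norm of a unitary matrix is fixed by its size, so the velocity is orthogonal to \<open>U t\<close> and
  the trace has no real part.
\<close>

lemma trace_unitary_path:
  fixes U :: "real \<Rightarrow> 'n::finite cmat"
  assumes dU: "(U has_vector_derivative u) (at t within {a..b})" and ab: "a < b" "t \<in> {a..b}"
    and unit: "\<And>t. t \<in> {a..b} \<Longrightarrow> unitary_matrix (U t)"
  shows "trace (conj_transpose (U t) ** u) = \<i> * complex_of_real (inner (cscale \<i> (U t)) u)"
proof -
  have "((\<lambda>s. inner (U s) (U s)) has_vector_derivative inner (U t) u + inner u (U t))
      (at t within {a..b})"
    using bounded_bilinear.has_vector_derivative[OF bounded_bilinear_inner dU dU] .
  moreover have "((\<lambda>s. inner (U s) (U s)) has_vector_derivative 0) (at t within {a..b})"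
    by (rule has_vector_derivative_transform
          [OF ab(2) _ has_vector_derivative_const[of "real CARD('n)"]])
      (use norm_unitary[OF unit] in \<open>simp add: power2_norm_eq_inner\<close>)
  ultimately have "inner (U t) u + inner u (U t) = 0"
    using ab vector_derivative_within_closed_interval by metis
  then have "Re (trace (conj_transpose (U t) ** u)) = 0"
    by (simp add: inner_commute flip: inner_eq_Re_trace)
  then show ?thesis
    by (simp add: complex_eq_iff inner_i_eq_Im_trace)
qed

section \<open>Optimality of the joint variation\<close>

lemma joint_variation_eq:
  assumes "\<And>t. t \<in> {0..1} \<Longrightarrow> (U has_vector_derivative u t) (at t within {0..1})"
    and "\<And>t. t \<in> {0..1} \<Longrightarrow> (V has_vector_derivative v t) (at t within {0..1})"
  shows "joint_variation U V = integral {0..1} (\<lambda>t. sqrt ((norm (u t))\<^sup>2 + (norm (v t))\<^sup>2))"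
  unfolding joint_variation_def
  by (rule integral_cong)
    (simp add: vector_derivative_within_closed_interval[OF zero_less_one _ assms(1)]
      vector_derivative_within_closed_interval[OF zero_less_one _ assms(2)])

text \<open>
  First-order optimality under \<open>U \<mapsto> cis \<phi> U\<close>, \<open>V \<mapsto> cis \<phi> V\<close>. With \<open>q\<close> the left-hand side of
  the claim and \<open>n\<close> the size of the matrices, the phase velocity \<open>a\<close> changes the squared joint speed
  by \<open>2 a q + 2 n a\<^sup>2\<close>. The minimum, at \<open>a = - q / (2 n)\<close>, is \<open>- q\<^sup>2 / (2 n)\<close>, so the integral
  would drop strictly unless \<open>q\<close> vanished identically.
\<close>

lemma joint_MVD_trace:
  fixes U V :: "real \<Rightarrow> ('n::{finite,linorder}) cmat"
  assumes mvd: "joint_MVD B U S V"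
    and dU: "\<And>t. t \<in> {0..1} \<Longrightarrow> (U has_vector_derivative u t) (at t within {0..1})"
    and dV: "\<And>t. t \<in> {0..1} \<Longrightarrow> (V has_vector_derivative v t) (at t within {0..1})"
    and u: "continuous_on {0..1} u" and v: "continuous_on {0..1} v"
    and t: "t \<in> {0..1}"
  shows "inner (cscale \<i> (U t)) (u t) + inner (cscale \<i> (V t)) (v t) = 0"
proof -
  define q where "q t = inner (cscale \<i> (U t)) (u t) + inner (cscale \<i> (V t)) (v t)" for t
  define a where "a t = - q t / (2 * CARD('n))" for t
  define \<phi> where "\<phi> t = integral {0..t} a" for t
  define U' where "U' t = cscale (cis (\<phi> t)) (U t)" for t
  define V' where "V' t = cscale (cis (\<phi> t)) (V t)" for t
  define u' where "u' t =
    cscale (cis (\<phi> t)) (u t) + cscale (\<i> * complex_of_real (a t) * cis (\<phi> t)) (U t)" for t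
  define v' where "v' t =
    cscale (cis (\<phi> t)) (v t) + cscale (\<i> * complex_of_real (a t) * cis (\<phi> t)) (V t)" for t
  have svd: "smooth_SVD B U S V"
    using mvd by (simp add: joint_MVD_def)
  have cU: "continuous_on {0..1} U" and cV: "continuous_on {0..1} V"
    by (rule continuous_on_vector_derivative, erule dU)
      (rule continuous_on_vector_derivative, erule dV)
  have q: "continuous_on {0..1} q"
    unfolding q_def by (intro continuous_intros cscale.continuous_on cU cV u v)
  then have a: "continuous_on {0..1} a"
    unfolding a_def by (intro continuous_intros) auto
  have d\<phi>: "(\<phi> has_vector_derivative a t) (at t within {0..1})" if "t \<in> {0..1}" for t
    unfolding \<phi>_def using integral_has_vector_derivative[OF a that] .
  then have \<phi>: "continuous_on {0..1} \<phi>"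
    by (rule continuous_on_vector_derivative)
  have cis\<phi>: "continuous_on {0..1} (\<lambda>t. cis (\<phi> t))"
    using \<phi> by (intro continuous_intros)
  have dU': "(U' has_vector_derivative u' t) (at t within {0..1})"
    and dV': "(V' has_vector_derivative v' t) (at t within {0..1})" if "t \<in> {0..1}" for t
    unfolding U'_def u'_def V'_def v'_def
    by (intro cscale.has_vector_derivative cis_has_vector_derivative d\<phi> dU dV that)+
  have u': "continuous_on {0..1} u'" and v': "continuous_on {0..1} v'"
    unfolding u'_def v'_def
    by (intro continuous_intros cscale.continuous_on cis\<phi> u v cU cV a)+
  have "smooth_SVD B U' S V'"
    unfolding smooth_SVD_def
  proof (intro conjI)
    show "C1_on {0..1} U'" "C1_on {0..1} V'"
      using dU' dV' u' v' unfolding C1_on_iff_vector_derivative by blast+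
    show "\<forall>t\<in>{0..1}. is_SVD (B t) (U' t) (S t) (V' t) \<and> strict_antimono_on UNIV (S t) \<and>
        (\<forall>j. 0 < S t j)"
      using svd unfolding smooth_SVD_def U'_def V'_def by (metis is_SVD_phase)
  qed (use svd in \<open>simp add: smooth_SVD_def\<close>)
  then have "joint_variation U V \<le> joint_variation U' V'"
    using mvd by (simp add: joint_MVD_def)
  let ?f = "\<lambda>t. sqrt ((norm (u t))\<^sup>2 + (norm (v t))\<^sup>2)"
  let ?g = "\<lambda>t. sqrt ((norm (u' t))\<^sup>2 + (norm (v' t))\<^sup>2)"
  have le: "integral {0..1} ?f \<le> integral {0..1} ?g"
  proof -
    have "joint_variation U V = integral {0..1} ?f"
      by (rule joint_variation_eq) (erule dU, erule dV)
    moreover have "joint_variation U' V' = integral {0..1} ?g"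
      by (rule joint_variation_eq) (erule dU', erule dV')
    ultimately show ?thesis
      using \<open>joint_variation U V \<le> joint_variation U' V'\<close> by simp
  qed
  have f: "continuous_on {0..1} ?f" and g: "continuous_on {0..1} ?g"
    by (intro continuous_intros u v u' v')+
  have unit: "unitary_matrix (U t)" "unitary_matrix (V t)" if "t \<in> {0..1}" for t
    using svd that by (auto simp: smooth_SVD_def is_SVD_def)
  have gain: "(norm (u' t))\<^sup>2 + (norm (v' t))\<^sup>2 =
    (norm (u t))\<^sup>2 + (norm (v t))\<^sup>2 - (q t)\<^sup>2 / (2 * CARD('n))" if "t \<in> {0..1}" for t
  proof -
    have "(norm (u' t))\<^sup>2 + (norm (v' t))\<^sup>2 =
      (norm (u t))\<^sup>2 + (norm (v t))\<^sup>2 + 2 * a t * q t + 2 * (a t)\<^sup>2 * CARD('n)"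
      unfolding u'_def v'_def q_def norm_rotating_frame[OF norm_unitary[OF unit(1)[OF that]]]
        norm_rotating_frame[OF norm_unitary[OF unit(2)[OF that]]]
      by (simp add: algebra_simps)
    then show ?thesis
      by (simp add: a_def power2_eq_square field_simps)
  qed
  have fg: "continuous_on {0..1} (\<lambda>t. ?f t - ?g t)"
    using f g by (rule continuous_on_diff)
  have gf: "?g t \<le> ?f t" if "t \<in> {0..1}" for t
    using gain[OF that] by simp
  have "integral {0..1} (\<lambda>t. ?f t - ?g t) = integral {0..1} ?f - integral {0..1} ?g"
    using f g by (intro integral_diff integrable_continuous_interval)
  moreover have "0 \<le> integral {0..1} (\<lambda>t. ?f t - ?g t)"
    using gf by (intro integral_nonneg integrable_continuous_interval fg) simp
  ultimately have "integral {0..1} (\<lambda>t. ?f t - ?g t) = 0"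
    using le by simp
  then have "?f t - ?g t = 0"
    using integral_eq_0_iff[OF fg zero_less_one] gf t by simp
  then have "q t = 0"
    using gain[OF t] by simp
  then show ?thesis
    by (simp add: q_def)
qed

lemma joint_MVD_det_mult_constant:
  fixes U V :: "real \<Rightarrow> ('n::{finite,linorder}) cmat"
  assumes mvd: "joint_MVD B U S V" and t: "t \<in> {0..1}"
  shows "det (U t) * det (V t) = det (U 0) * det (V 0)"
proof -
  have svd: "smooth_SVD B U S V"
    using mvd by (simp add: joint_MVD_def)
  then obtain u v
    where dU: "\<And>t. t \<in> {0..1} \<Longrightarrow> (U has_vector_derivative u t) (at t within {0..1})"
    and dV: "\<And>t. t \<in> {0..1} \<Longrightarrow> (V has_vector_derivative v t) (at t within {0..1})"
    and u: "continuous_on {0..1} u" and v: "continuous_on {0..1} v"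
    unfolding smooth_SVD_def C1_on_iff_vector_derivative by blast
  have unit: "unitary_matrix (U t)" "unitary_matrix (V t)" if "t \<in> {0..1}" for t
    using svd that by (auto simp: smooth_SVD_def is_SVD_def)
  have "((\<lambda>s. det (U s) * det (V s)) has_vector_derivative 0) (at s within {0..1})"
    if s: "s \<in> {0..1}" for s
  proof (rule has_vector_derivative_eq_rhs)
    show "((\<lambda>s. det (U s) * det (V s)) has_vector_derivative
      det (U s) * (det (V s) * trace (conj_transpose (V s) ** v s)) +
      det (U s) * trace (conj_transpose (U s) ** u s) * det (V s)) (at s within {0..1})"
      by (intro has_vector_derivative_mult det_unitary_has_vector_derivative dU dV s unit)
    have "trace (conj_transpose (U s) ** u s) + trace (conj_transpose (V s) ** v s) =
      \<i> * complex_of_real (inner (cscale \<i> (U s)) (u s) + inner (cscale \<i> (V s)) (v s))"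
      using trace_unitary_path[OF dU[OF s] zero_less_one s unit(1)]
        trace_unitary_path[OF dV[OF s] zero_less_one s unit(2)]
      by (simp add: distrib_left)
    then have "trace (conj_transpose (V s) ** v s) = - trace (conj_transpose (U s) ** u s)"
      using joint_MVD_trace[OF mvd dU dV u v s] by (simp add: add_eq_0_iff)
    then show "det (U s) * (det (V s) * trace (conj_transpose (V s) ** v s)) +
      det (U s) * trace (conj_transpose (U s) ** u s) * det (V s) = 0"
      by simp
  qed
  then obtain c where "\<And>s. s \<in> {0..1} \<Longrightarrow> det (U s) * det (V s) = c"
    using has_vector_derivative_zero_constant[of "{0..1}" "\<lambda>s. det (U s) * det (V s)"]
    by auto
  with t show ?thesis by simp
qed

text \<open>
  With \<open>c = det (U 0) \<cdot> det (V 0) = det (U t) \<cdot> det (V t)\<close>, the unit number \<open>cnj (det (V t))\<close> is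
  \<open>det (U t) / c\<close>, and the product of the singular values is \<open>\<bar>det (B t)\<bar>\<close>.
\<close>

lemma joint_MVD_det_squared:
  assumes mvd: "joint_MVD B U S V" and t: "t \<in> {0..1}"
  shows "det (U 0) * det (V 0) * det (B t) = (det (U t))\<^sup>2 * complex_of_real (norm (det (B t)))"
proof -
  define p where "p = (\<Prod>j\<in>UNIV. S t j)"
  have svd: "is_SVD (B t) (U t) (S t) (V t)"
    using mvd t by (auto simp: joint_MVD_def smooth_SVD_def)
  then have B: "det (B t) = det (U t) * complex_of_real p * cnj (det (V t))"
    by (simp add: is_SVD_def det_mul det_diag_matrix det_conj_transpose p_def)
  have U: "cnj (det (U t)) * det (U t) = 1" and V: "cnj (det (V t)) * det (V t) = 1"
    using svd by (auto simp: is_SVD_def intro: det_unitary)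
  have "norm (det (U t)) = 1" "norm (det (V t)) = 1"
    using U V complex_norm_square
    by (metis abs_norm_cancel abs_square_eq_1 mult.commute of_real_eq_1_iff)+
  moreover have "0 \<le> p"
    using svd by (auto simp: p_def is_SVD_def intro: prod_nonneg)
  ultimately have "norm (det (B t)) = p"
    by (simp add: B norm_mult)
  then have "(det (U t))\<^sup>2 * complex_of_real (norm (det (B t))) =
    (det (U t))\<^sup>2 * complex_of_real p * (cnj (det (V t)) * det (V t))"
    by (simp add: V)
  also have "\<dots> = (det (U t) * det (V t)) * det (B t)"
    by (simp add: B power2_eq_square)
  finally show ?thesis
    by (simp add: joint_MVD_det_mult_constant[OF mvd t])
qed

section \<open>The phases after one turn\<close>

theorem theorem3p11:
  fixes \<Omega> :: "(real \<times> real) set"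
    and A :: "real \<times> real \<Rightarrow> ('n::{finite,linorder}) cmat"
    and \<sigma> :: "real \<times> real \<Rightarrow> 'n \<Rightarrow> real"
    and \<xi>\<^sub>0 :: "real \<times> real" and r :: real
    and U V :: "real \<Rightarrow> 'n cmat" and S :: "real \<Rightarrow> 'n \<Rightarrow> real"
    and \<beta> :: "'n \<Rightarrow> real"
  assumes "CARD('n) \<ge> 2"
    and "open \<Omega>" and "simply_connected \<Omega>"
    and "C1_on \<Omega> A"
    and "\<And>\<xi>. \<xi> \<in> \<Omega> \<Longrightarrow> has_singular_values (A \<xi>) (\<sigma> \<xi>)"
    and "\<And>\<xi>. \<xi> \<in> \<Omega> \<Longrightarrow> strict_antimono_on UNIV (\<sigma> \<xi>)"
    and "generic_loss_of_rank \<Omega> A \<xi>\<^sub>0"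
    and "\<And>\<xi>. \<xi> \<in> \<Omega> - {\<xi>\<^sub>0} \<Longrightarrow> rank (A \<xi>) = CARD('n)"
    and "r > 0" and "sphere \<xi>\<^sub>0 r \<subseteq> \<Omega>"
    and "joint_MVD (\<lambda>t. A (circle_path \<xi>\<^sub>0 r t)) U S V"
    and "\<And>j. \<beta> j \<in> {-pi<..pi}"
    and "conj_transpose (U 0) ** U 1 = diag_matrix (\<lambda>j. cis (\<beta> j))"
    and "conj_transpose (V 0) ** V 1 = diag_matrix (\<lambda>j. cis (\<beta> j))"
  shows "[(\<Sum>j\<in>UNIV. \<beta> j) = pi] (rmod (2 * pi))"
proof -
  let ?\<gamma> = "circle_path \<xi>\<^sub>0 r"
  let ?f = "\<lambda>\<xi>. det (A \<xi>)"
  let ?B = "\<lambda>t. A (?\<gamma> t)"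
  have disc: "cball \<xi>\<^sub>0 r \<subseteq> \<Omega>"
    using assms(2,3,9,10) by (rule disc_subset_of_simply_connected)
  have mem: "?\<gamma> t \<in> cball \<xi>\<^sub>0 r - {\<xi>\<^sub>0}" for t
    using assms(9) unit_vector_nonzero[of t] by (simp add: circle_path_eq dist_norm)
  have "continuous_on \<Omega> A"
    using assms(4) unfolding C1_on_def by (meson has_derivative_continuous_on)
  then have f: "continuous_on (cball \<xi>\<^sub>0 r) ?f"
    using disc by (intro continuous_on_det) (rule continuous_on_subset)
  have f_nz: "?f \<xi> \<noteq> 0" if "\<xi> \<in> cball \<xi>\<^sub>0 r - {\<xi>\<^sub>0}" for \<xi>
    using that disc assms(8) by (intro det_nonzero_of_full_rank) blast
  obtain D where f0: "?f \<xi>\<^sub>0 = 0" and D: "bij D"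
    and dF: "((\<lambda>\<zeta>. (Re (?f \<zeta>), Im (?f \<zeta>))) has_derivative D) (at \<xi>\<^sub>0)"
    using assms(7) by (auto simp: generic_loss_of_rank_def regular_zero_def complex_eq_iff zero_prod_def)
  define L where "L h = complex_of_real (fst (D h)) + \<i> * complex_of_real (snd (D h))" for h
  have L: "(?f has_derivative L) (at \<xi>\<^sub>0)"
    using has_derivative_add[OF has_derivative_of_real[OF has_derivative_fst[OF dF]]
        has_derivative_mult_right[OF has_derivative_of_real[OF has_derivative_snd[OF dF]], of \<i>]]
    by (simp add: L_def[abs_def] flip: complex_eq)
  have L_nz: "L h \<noteq> 0" if "h \<noteq> 0" for h
  proof
    assume "L h = 0"
    then have "D h = D 0"
      using linear_0[OF has_derivative_linear[OF dF]]
      by (simp add: L_def complex_eq_iff prod_eq_iff)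
    with D that show False
      by (auto dest: bij_is_inj injD)
  qed
  define c where "c = det (U 0) * det (V 0)"
  have svd: "smooth_SVD ?B U S V"
    using assms(11) by (simp add: joint_MVD_def)
  have unit: "unitary_matrix (U 0)" "unitary_matrix (V 0)"
    using svd by (auto simp: smooth_SVD_def is_SVD_def)
  have c: "c \<noteq> 0"
    using det_unitary[OF unit(1)] det_unitary[OF unit(2)] by (auto simp: c_def)
  \<comment> \<open>a square root of \<open>det A\<close> along the circle, proportional to \<open>det U\<close> up to a positive factor\<close>
  define k where "k t = det (U t) * complex_of_real (sqrt (norm (?f (?\<gamma> t)))) / csqrt c" for t
  have "continuous_on {0..1} U"
    using svd unfolding smooth_SVD_def C1_on_def by (meson has_derivative_continuous_on)
  moreover have "continuous_on {0..1} (\<lambda>t. ?f (?\<gamma> t))"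
    by (rule continuous_on_compose2[OF f])
      (use mem in \<open>auto simp: circle_path_eq[abs_def] intro!: continuous_intros\<close>)
  ultimately have k: "continuous_on {0..1} k"
    unfolding k_def using c by (auto intro!: continuous_intros intro: continuous_on_det)
  have k_sq: "(k t)\<^sup>2 = ?f (?\<gamma> t)" if "t \<in> {0..1}" for t
  proof -
    have "c * ?f (?\<gamma> t) = (det (U t))\<^sup>2 * complex_of_real (norm (?f (?\<gamma> t)))"
      unfolding c_def by (rule joint_MVD_det_squared[OF assms(11) that])
    then show ?thesis
      using c by (simp add: k_def power_divide power_mult_distrib field_simps flip: of_real_power)
  qed
  have "k 1 = - k 0"
    by (rule sqrt_around_regular_zero[OF assms(9) f f_nz f0 L L_nz k k_sq])
  moreover have "?\<gamma> 1 = ?\<gamma> 0"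
    by (simp add: circle_path_eq unit_vector_one)
  ultimately have "complex_of_real (sqrt (norm (?f (?\<gamma> 0)))) * det (U 1) =
      complex_of_real (sqrt (norm (?f (?\<gamma> 0)))) * - det (U 0)"
    using c by (simp add: k_def field_simps)
  then have "det (U 1) = - det (U 0)"
    using f_nz[OF mem[of 0]] by (simp only: mult_cancel_left) simp
  then have "det (conj_transpose (U 0) ** U 1) = - 1"
    using det_unitary[OF unit(1)] by (simp add: det_mul det_conj_transpose)
  then have "cis (\<Sum>j\<in>UNIV. \<beta> j) = cis pi"
    by (simp add: assms(13) det_diag_matrix cis_prod)
  then show ?thesis
    by (simp only: cis_eq_iff)
qed

end
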